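(* Let $X$ be a Banach lattice having weakly sequentially continuous lattice operations. Then $X$ is LWCG (weakly compactly generated as a lattice) if and only if $X$ is WCG (weakly compactly generated as a Banach space).
   Context: A Banach lattice has weakly sequentially continuous lattice operations if $x_n\vee y_n$ converges weakly to $x\vee y$ whenever the sequences $(x_n)$ and $(y_n)$ converge weakly to $x$ and $y$, respectively. Subspaces and sublattices are assumed to be (norm) closed; a sublattice of $X$ is a subspace closed under $\vee$ and $\wedge$. For $A\subset X$, $\overline{\mathrm{span}}(A)$ is the closed linear span of $A$ and $L(A)$ is the smallest (closed) sublattice of $X$ containing $A$. $X$ is LWCG if there is a weakly compact set $K\subset X$ with $X=L(K)$. $X$ is WCG if there is a weakly compact set $K\subset X$ with $X=\overline{\mathrm{span}}(K)$. *)

theory Defs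
  imports "HOL-Analysis.Analysis"
begin

text \<open>Real Banach lattices. The modulus of \<open>x\<close> is written out as \<open>sup x (- x)\<close>.\<close>

class banach_lattice = banach + ordered_real_vector + lattice +
  assumes norm_mono_modulus: "sup x (- x) \<le> sup y (- y) \<Longrightarrow> norm x \<le> norm y"

instance real :: banach_lattice
  by standard (simp add: sup_real_def max_def split: if_splits)

text \<open>The weak topology: the coarsest topology for which every bounded linear functional
  is continuous.\<close>

definition weak_topology :: "'a::real_normed_vector topology" where
  "weak_topology =
     topology_generated_by {f -` U | (f :: 'a \<Rightarrow> real) U. bounded_linear f \<and> open U}"

lemma topspace_weak_topology [simp]: "topspace weak_topology = UNIV"
proof -
  have "UNIV = (\<lambda>x::'a. 0::real) -` UNIV" by simp
  then have "UNIV \<in> {f -` U | (f :: 'a \<Rightarrow> real) U. bounded_linear f \<and> open U}"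
    using bounded_linear_zero open_UNIV by blast
  then show ?thesis
    unfolding weak_topology_def topology_generated_by_topspace by blast
qed

lemma limitin_weak_topology:
  "limitin weak_topology u l F \<longleftrightarrow>
     (\<forall>f :: 'a::real_normed_vector \<Rightarrow> real. bounded_linear f \<longrightarrow> ((\<lambda>n. f (u n)) \<longlongrightarrow> f l) F)"
proof (intro iffI allI impI)
  fix f :: "'a \<Rightarrow> real"
  assume lim: "limitin weak_topology u l F" and f: "bounded_linear f"
  show "((\<lambda>n. f (u n)) \<longlongrightarrow> f l) F"
  proof (rule topological_tendstoI)
    fix U :: "real set" assume U: "open U" "f l \<in> U"
    have "openin weak_topology (f -` U)"
      unfolding weak_topology_def using f U by (intro topology_generated_by_Basis) blast
    from limitinD[OF lim this] U show "\<forall>\<^sub>F n in F. f (u n) \<in> U" by simp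
  qed
next
  assume R: "\<forall>f :: 'a \<Rightarrow> real. bounded_linear f \<longrightarrow> ((\<lambda>n. f (u n)) \<longlongrightarrow> f l) F"
  have "l \<in> V \<longrightarrow> (\<forall>\<^sub>F n in F. u n \<in> V)"
    if "generate_topology_on {f -` U | (f :: 'a \<Rightarrow> real) U. bounded_linear f \<and> open U} V" for V
    using that
  proof induction
    case (Int a b)
    then show ?case by (auto simp: eventually_conj_iff)
  next
    case (UN K)
    show ?case
    proof
      assume "l \<in> \<Union>K"
      then obtain k where k: "k \<in> K" "l \<in> k" by blast
      with UN.IH have "\<forall>\<^sub>F n in F. u n \<in> k" by blast
      then show "\<forall>\<^sub>F n in F. u n \<in> \<Union>K" by (rule eventually_mono) (use k in blast)
    qed
  next
    case (Basis s)
    then obtain f :: "'a \<Rightarrow> real" and U where "s = f -` U" "bounded_linear f" "open U" by auto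
    then show ?case using R topological_tendstoD by fastforce
  qed simp
  then show "limitin weak_topology u l F"
    unfolding limitin_def topspace_weak_topology
    by (simp add: weak_topology_def openin_topology_generated_by_iff)
qed

definition weakly_seq_continuous_lattice_ops :: "'a::banach_lattice itself \<Rightarrow> bool" where
  "weakly_seq_continuous_lattice_ops _ \<longleftrightarrow>
     (\<forall>(x :: nat \<Rightarrow> 'a) y a b.
        limitin weak_topology x a sequentially \<longrightarrow>
        limitin weak_topology y b sequentially \<longrightarrow>
        limitin weak_topology (\<lambda>n. sup (x n) (y n)) (sup a b) sequentially)"

definition closed_sublattice :: "'a::banach_lattice set \<Rightarrow> bool" where
  "closed_sublattice S \<longleftrightarrow>
     subspace S \<and> closed S \<and> (\<forall>x\<in>S. \<forall>y\<in>S. sup x y \<in> S \<and> inf x y \<in> S)"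

lemma closed_sublattice_hull: "closed_sublattice (closed_sublattice hull A)"
  by (rule hull_in) (auto simp: closed_sublattice_def intro: subspace_Inter)

definition LWCG :: "'a::banach_lattice itself \<Rightarrow> bool" where
  "LWCG _ \<longleftrightarrow> (\<exists>K :: 'a set. compactin weak_topology K \<and> closed_sublattice hull K = UNIV)"

definition WCG :: "'a::banach itself \<Rightarrow> bool" where
  "WCG _ \<longleftrightarrow> (\<exists>K :: 'a set. compactin weak_topology K \<and> closure (span K) = UNIV)"

end

theory Submission
  imports Defs "HOL-Library.Lattice_Algebras"
begin

text \<open>A closed sublattice is a closed subspace, so \<open>WCG\<close> gives \<open>LWCG\<close>. Conversely, sequences suffice to
  describe weak closures inside a weakly compact set (Whitley), so the weakly sequentially continuous
  map \<open>x \<mapsto> sup x 0\<close> is weakly continuous on weakly compact sets and preserves weak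
  compactness. Starting from a weakly compact \<open>K\<close> and alternating this map with linear combinations
  with bounded scalars, the vector sublattice generated by \<open>K\<close> becomes a countable union of weakly
  compact sets. These are bounded, and rescaling them so that they shrink to \<open>0\<close> makes the union
  itself, together with \<open>0\<close>, weakly compact without changing its span.\<close>

section \<open>Hahn-Banach via minimal sublinear functionals\<close>

definition sublinear :: "('a::real_vector \<Rightarrow> real) \<Rightarrow> bool" where
  "sublinear q \<longleftrightarrow> (\<forall>x y. q (x + y) \<le> q x + q y) \<and> (\<forall>c x. c > 0 \<longrightarrow> q (c *\<^sub>R x) = c * q x)"

lemma sublinear_add: "sublinear q \<Longrightarrow> q (x + y) \<le> q x + q y"
  by (simp add: sublinear_def)

lemma sublinear_scale: "sublinear q \<Longrightarrow> c > 0 \<Longrightarrow> q (c *\<^sub>R x) = c * q x"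
  by (simp add: sublinear_def)

lemma sublinear_zero: "sublinear q \<Longrightarrow> q 0 = 0"
  using sublinear_scale[of q 2 0] by simp

lemma sublinear_neg: "sublinear q \<Longrightarrow> - q (- x) \<le> q x"
  using sublinear_add[of q x "- x"] sublinear_zero[of q] by simp

text \<open>One scaling inequality suffices: using it with \<open>inverse c\<close> at the point
  \<open>c *\<^sub>R x\<close> gives the reverse one.\<close>

lemma sublinearI:
  assumes "\<And>x y. q (x + y) \<le> q x + q y" and le: "\<And>c x. c > 0 \<Longrightarrow> q (c *\<^sub>R x) \<le> c * q x"
  shows "sublinear q"
proof -
  have "q (c *\<^sub>R x) = c * q x" if c: "c > 0" for c x
  proof (rule antisym)
    have "q (inverse c *\<^sub>R c *\<^sub>R x) \<le> inverse c * q (c *\<^sub>R x)"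
      using c by (intro le) auto
    then show "c * q x \<le> q (c *\<^sub>R x)"
      using c by (simp add: field_simps)
  qed (use le c in blast)
  with assms(1) show ?thesis by (simp add: sublinear_def)
qed

lemma cINF_add_le:
  fixes f g h :: "'b \<Rightarrow> real"
  assumes "I \<noteq> {}"
    and le: "\<And>s t. s \<in> I \<Longrightarrow> t \<in> I \<Longrightarrow> a \<le> f s + g t"
  shows "a \<le> (INF s\<in>I. f s) + (INF t\<in>I. g t)"
proof -
  have "a - f s \<le> (INF t\<in>I. g t)" if "s \<in> I" for s
    using le[OF that] by (intro cINF_greatest assms) (simp add: algebra_simps)
  then have "a - (INF t\<in>I. g t) \<le> (INF s\<in>I. f s)"
    by (intro cINF_greatest assms) (simp add: algebra_simps)
  then show ?thesis by simp
qed

text \<open>For members \<open>q\<close> and \<open>r\<close> of the chain, the smaller one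
  \<open>s\<close> satisfies \<open>s (x + y) \<le> s x + s y\<close>, which is at most
  \<open>q x + r y\<close>. So the infima at \<open>x\<close> and at \<open>y\<close> can be taken
  independently.\<close>

lemma sublinear_INF:
  fixes C :: "('a::real_vector \<Rightarrow> real) set"
  assumes ne: "C \<noteq> {}" and sub: "\<And>q. q \<in> C \<Longrightarrow> sublinear q"
    and chain: "\<And>q r. q \<in> C \<Longrightarrow> r \<in> C \<Longrightarrow> q \<le> r \<or> r \<le> q"
    and bdd: "\<And>x. bdd_below ((\<lambda>q. q x) ` C)"
  shows "sublinear (\<lambda>x. INF q\<in>C. q x)"
proof (rule sublinearI)
  fix x y :: 'a
  show "(INF q\<in>C. q (x + y)) \<le> (INF q\<in>C. q x) + (INF q\<in>C. q y)"
  proof (rule cINF_add_le[OF ne])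
    fix q r assume qr: "q \<in> C" "r \<in> C"
    have "(INF q\<in>C. q (x + y)) \<le> s (x + y)" if "s \<in> C" for s
      using bdd that by (rule cINF_lower)
    moreover have "s (x + y) \<le> s x + s y" if "s \<in> C" for s
      using sub[OF that] by (rule sublinear_add)
    ultimately show "(INF q\<in>C. q (x + y)) \<le> q x + r y"
      using chain[OF qr] qr by (smt (verit) le_fun_def)
  qed
next
  fix c :: real and x :: 'a assume c: "c > 0"
  have "(INF q\<in>C. q (c *\<^sub>R x)) / c \<le> (INF q\<in>C. q x)"
  proof (rule cINF_greatest[OF ne])
    fix q assume q: "q \<in> C"
    have "(INF q\<in>C. q (c *\<^sub>R x)) \<le> q (c *\<^sub>R x)"
      using bdd q by (rule cINF_lower)
    then show "(INF q\<in>C. q (c *\<^sub>R x)) / c \<le> q x"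
      using c sublinear_scale[OF sub[OF q] c] by (simp add: field_simps)
  qed
  then show "(INF q\<in>C. q (c *\<^sub>R x)) \<le> c * (INF q\<in>C. q x)"
    using c by (simp add: field_simps)
qed

text \<open>A minimal sublinear functional equals the \<open>r\<close> obtained from it, so the last property with
  \<open>r = q\<close>, valid for every \<open>y\<close>, makes it additive.\<close>

lemma sublinear_directional:
  fixes q :: "'a::real_vector \<Rightarrow> real"
  assumes q: "sublinear q"
  obtains r where "sublinear r" "r \<le> q" "\<And>x. r x \<le> q (x + y) - q y"
proof
  \<comment> \<open>An infimum along the ray from \<open>x\<close> in direction \<open>y\<close>:
    \<open>t = 0\<close> gives \<open>r \<le> q\<close>, and \<open>t = 1\<close> gives the last
    property.\<close>
  define r where "r x = (INF t\<in>{0..}. q (x + t *\<^sub>R y) - t * q y)" for x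
  have bdd: "bdd_below ((\<lambda>t. q (x + t *\<^sub>R y) - t * q y) ` {0..})" for x
  proof (rule bdd_belowI2)
    fix t :: real assume "t \<in> {0..}"
    then have "q (t *\<^sub>R y) = t * q y"
      using sublinear_scale[OF q, of t y] sublinear_zero[OF q] by (cases "t = 0") auto
    then show "- q (- x) \<le> q (x + t *\<^sub>R y) - t * q y"
      using sublinear_add[OF q, of "x + t *\<^sub>R y" "- x"] by simp
  qed
  have r_le: "r x \<le> q (x + t *\<^sub>R y) - t * q y" if "t \<ge> 0" for x t
    unfolding r_def by (rule cINF_lower[OF bdd]) (use that in simp)
  show "r \<le> q" using r_le[of 0] by (simp add: le_fun_def)
  show "r x \<le> q (x + y) - q y" for x using r_le[of 1] by simp
  show "sublinear r"
  proof (rule sublinearI)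
    fix u v
    have "r (u + v) \<le> (q (u + s *\<^sub>R y) - s * q y) + (q (v + t *\<^sub>R y) - t * q y)"
      if "s \<in> {0..}" "t \<in> {0..}" for s t
      using r_le[of "s + t" "u + v"] that sublinear_add[OF q, of "u + s *\<^sub>R y" "v + t *\<^sub>R y"]
      by (simp add: algebra_simps)
    then show "r (u + v) \<le> r u + r v"
      unfolding r_def[of u] r_def[of v] by (intro cINF_add_le) auto
  next
    fix c :: real and x assume c: "c > 0"
    have "r (c *\<^sub>R x) / c \<le> r x"
      unfolding r_def[of x]
    proof (rule cINF_greatest)
      fix t :: real assume "t \<in> {0..}"
      then have "r (c *\<^sub>R x) \<le> q (c *\<^sub>R x + (c * t) *\<^sub>R y) - c * t * q y"
        using c by (intro r_le) auto
      also have "\<dots> = c * (q (x + t *\<^sub>R y) - t * q y)"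
        using sublinear_scale[OF q c, of "x + t *\<^sub>R y"] by (simp add: algebra_simps)
      finally show "r (c *\<^sub>R x) / c \<le> q (x + t *\<^sub>R y) - t * q y"
        using c by (simp add: field_simps)
    qed auto
    then show "r (c *\<^sub>R x) \<le> c * r x" using c by (simp add: field_simps)
  qed
qed

text \<open>Zorn's lemma for the reversed pointwise order; a nonempty chain is bounded by its
  pointwise infimum.\<close>

lemma sublinear_minimal:
  fixes p :: "'a::real_vector \<Rightarrow> real"
  assumes p: "sublinear p"
  obtains m where "sublinear m" "m \<le> p" "\<And>q. sublinear q \<Longrightarrow> q \<le> m \<Longrightarrow> q = m"
proof -
  define A where "A = {q. sublinear q \<and> q \<le> p}"
  have "\<exists>m\<in>A. \<forall>a\<in>A. a \<le> m \<longrightarrow> a = m"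
  proof (rule predicate_Zorn)
    show "partial_order_on A (relation_of (\<lambda>x y. y \<le> x) A)"
      by (rule partial_order_on_relation_ofI) auto
    fix C assume C: "C \<in> Chains (relation_of (\<lambda>x y. y \<le> x) A)"
    then have CA: "C \<subseteq> A" and chain: "\<And>q r. q \<in> C \<Longrightarrow> r \<in> C \<Longrightarrow> q \<le> r \<or> r \<le> q"
      by (auto simp: Chains_def relation_of_def)
    show "\<exists>u\<in>A. \<forall>a\<in>C. u \<le> a"
    proof (cases "C = {}")
      case True
      then show ?thesis using p by (auto simp: A_def)
    next
      case False
      \<comment> \<open>The bound \<open>- p (- x)\<close> is common to all sublinear functionals
        below \<open>p\<close>, because \<open>- p (- x) \<le> - q (- x) \<le> q x\<close>.\<close>
      have bdd: "bdd_below ((\<lambda>q. q x) ` C)" for x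
      proof (rule bdd_belowI2)
        fix q assume "q \<in> C"
        then have "sublinear q" "q (- x) \<le> p (- x)" using CA by (auto simp: A_def le_fun_def)
        then show "- p (- x) \<le> q x" using sublinear_neg[of q x] by simp
      qed
      have lower: "(\<lambda>x. INF q\<in>C. q x) \<le> a" if "a \<in> C" for a
        unfolding le_fun_def using cINF_lower[OF bdd that] by auto
      have "sublinear (\<lambda>x. INF q\<in>C. q x)"
        by (rule sublinear_INF[OF False _ chain bdd]) (use CA in \<open>auto simp: A_def\<close>)
      moreover obtain a where "a \<in> C" using False by blast
      then have "(\<lambda>x. INF q\<in>C. q x) \<le> p"
        using order_trans[OF lower[of a], of p] CA by (auto simp: A_def)
      ultimately have "(\<lambda>x. INF q\<in>C. q x) \<in> A"
        unfolding A_def by blast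
      with lower show ?thesis by blast
    qed
  qed
  then show thesis using that by (auto simp: A_def)
qed

text \<open>A minimal functional is linear, but it may miss the value of \<open>p\<close> at
  \<open>y\<close>. Minimizing below an \<open>r\<close> with \<open>r (- y) \<le> - p y\<close>
  forces that value.\<close>

theorem Hahn_Banach_sublinear:
  fixes p :: "'a::real_vector \<Rightarrow> real"
  assumes p: "sublinear p"
  obtains f where "linear f" "\<And>x. f x \<le> p x" "f y = p y"
proof -
  obtain r where r: "sublinear r" "r \<le> p" "\<And>x. r x \<le> p (x + y) - p y"
    using sublinear_directional[OF p, where y=y] by blast
  obtain m where m: "sublinear m" "m \<le> r" "\<And>q. sublinear q \<Longrightarrow> q \<le> m \<Longrightarrow> q = m"
    using sublinear_minimal[OF r(1)] by blast
  have add: "m (x + z) = m x + m z" for x z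
  proof (rule antisym)
    \<comment> \<open>Minimality gives \<open>q = m\<close>, so the bound on \<open>q\<close>
      becomes superadditivity of \<open>m\<close>.\<close>
    obtain q where "sublinear q" "q \<le> m" "\<And>x. q x \<le> m (x + z) - m z"
      using sublinear_directional[OF m(1), where y=z] by blast
    with m(3)[of q] show "m x + m z \<le> m (x + z)" by (simp add: le_diff_eq)
  qed (rule sublinear_add[OF m(1)])
  have neg: "m (- x) = - m x" for x
    using add[of x "- x"] sublinear_zero[OF m(1)] by simp
  have "m (c *\<^sub>R x) = c * m x" for c x
  proof (cases c "0::real" rule: linorder_cases)
    case less
    then show ?thesis using sublinear_scale[OF m(1), of "- c" x] neg[of "c *\<^sub>R x"] by simp
  qed (use sublinear_scale[OF m(1)] sublinear_zero[OF m(1)] in auto)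
  with add have "linear m" by (intro linearI) auto
  moreover have le: "m x \<le> p x" for x using order_trans[OF m(2) r(2)] by (simp add: le_fun_def)
  moreover have "m y = p y"
  proof (rule antisym[OF le])
    have "m (- y) \<le> r (- y)" using m(2) by (simp add: le_fun_def)
    also have "\<dots> \<le> - p y" using r(3)[of "- y"] sublinear_zero[OF p] by simp
    finally show "p y \<le> m y" using neg by simp
  qed
  ultimately show thesis using that by blast
qed

section \<open>Norming and separating functionals\<close>

lemma bounded_linear_dominated:
  fixes f :: "'a::real_normed_vector \<Rightarrow> real"
  assumes "linear f" "\<And>x. f x \<le> norm x"
  shows "bounded_linear f" "\<And>x. \<bar>f x\<bar> \<le> norm x"
proof -
  show abs: "\<bar>f x\<bar> \<le> norm x" for x
    using assms(2)[of x] assms(2)[of "- x"] linear_neg[OF assms(1), of x] by simp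
  then show "bounded_linear f"
    using assms(1) by (auto intro!: bounded_linear_intro[of f 1] simp: linear_add linear_scale)
qed

lemma norming_functional:
  fixes x :: "'a::real_normed_vector"
  obtains f :: "'a \<Rightarrow> real" where "bounded_linear f" "\<And>z. \<bar>f z\<bar> \<le> norm z" "f x = norm x"
proof -
  have "sublinear (norm :: 'a \<Rightarrow> real)"
    by (simp add: sublinear_def norm_triangle_ineq)
  then obtain f :: "'a \<Rightarrow> real" where "linear f" "\<And>x. f x \<le> norm x" "f x = norm x"
    using Hahn_Banach_sublinear[where y=x] by blast
  with bounded_linear_dominated[of f] that show thesis by blast
qed

lemma infdist_subspace_sublinear:
  fixes Z :: "'a::real_normed_vector set"
  assumes Z: "subspace Z"
  shows "sublinear (\<lambda>x. infdist x Z)"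
proof (rule sublinearI)
  have ne: "Z \<noteq> {}" using subspace_0[OF Z] by auto
  fix x y :: 'a
  have "infdist (x + y) Z \<le> dist x a + dist y b" if "a \<in> Z" "b \<in> Z" for a b
  proof -
    have "infdist (x + y) Z \<le> dist (x + y) (a + b)"
      by (rule infdist_le) (use subspace_add[OF Z] that in auto)
    also have "\<dots> \<le> dist x a + dist y b" by (rule dist_triangle_add)
    finally show ?thesis .
  qed
  then show "infdist (x + y) Z \<le> infdist x Z + infdist y Z"
    unfolding infdist_notempty[OF ne, of x] infdist_notempty[OF ne, of y]
    by (intro cINF_add_le ne)
next
  have ne: "Z \<noteq> {}" using subspace_0[OF Z] by auto
  fix c :: real and x :: 'a assume c: "c > 0"
  have "infdist (c *\<^sub>R x) Z / c \<le> infdist x Z"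
    unfolding infdist_notempty[OF ne, of x]
  proof (rule cINF_greatest[OF ne])
    fix a assume "a \<in> Z"
    then have "infdist (c *\<^sub>R x) Z \<le> dist (c *\<^sub>R x) (c *\<^sub>R a)"
      by (intro infdist_le) (use subspace_scale[OF Z] in auto)
    also have "\<dots> = c * dist x a" using c by (simp add: dist_norm flip: scaleR_right_diff_distrib)
    finally show "infdist (c *\<^sub>R x) Z / c \<le> dist x a" using c by (simp add: field_simps)
  qed
  then show "infdist (c *\<^sub>R x) Z \<le> c * infdist x Z" using c by (simp add: field_simps)
qed

text \<open>Hahn-Banach with the distance to \<open>Z\<close> as majorant. The functional is at most
  \<open>0\<close> at both \<open>z\<close> and \<open>- z\<close> for \<open>z \<in> Z\<close>, it
  is bounded because \<open>0 \<in> Z\<close>, and at \<open>y\<close> it equals the distance, which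
  is nonzero as \<open>Z\<close> is closed.\<close>

lemma separating_functional_subspace:
  fixes Z :: "'a::real_normed_vector set"
  assumes Z: "subspace Z" "closed Z" and y: "y \<notin> Z"
  obtains f :: "'a \<Rightarrow> real" where "bounded_linear f" "\<And>z. z \<in> Z \<Longrightarrow> f z = 0" "f y \<noteq> 0"
proof -
  have ne: "Z \<noteq> {}" using subspace_0[OF Z(1)] by auto
  obtain f :: "'a \<Rightarrow> real" where f: "linear f" "\<And>x. f x \<le> infdist x Z" "f y = infdist y Z"
    using Hahn_Banach_sublinear[OF infdist_subspace_sublinear[OF Z(1)], where y=y] by blast
  have "f x \<le> norm x" for x
    using f(2)[of x] infdist_le[OF subspace_0[OF Z(1)], of x] by simp
  then have "bounded_linear f" using bounded_linear_dominated f(1) by blast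
  moreover have "f z = 0" if "z \<in> Z" for z
    using f(2)[of z] f(2)[of "- z"] linear_neg[OF f(1), of z] that subspace_neg[OF Z(1) that] by simp
  moreover have "f y \<noteq> 0"
    using f(3) y in_closed_iff_infdist_zero[OF Z(2) ne] by simp
  ultimately show thesis using that by blast
qed

section \<open>Weak topology and weakly compact sets\<close>

lemma continuous_map_weak_functional:
  fixes f :: "'a::real_normed_vector \<Rightarrow> real"
  assumes "bounded_linear f"
  shows "continuous_map weak_topology euclideanreal f"
  unfolding continuous_map_def
proof (intro conjI allI impI)
  fix U :: "real set" assume "openin euclideanreal U"
  then have "f -` U \<in> {f -` U | (f :: 'a \<Rightarrow> real) U. bounded_linear f \<and> open U}"
    using assms by auto
  then have "openin weak_topology (f -` U)"
    unfolding weak_topology_def by (rule topology_generated_by_Basis)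
  then show "openin weak_topology {x \<in> topspace weak_topology. f x \<in> U}"
    by (simp add: vimage_def)
qed simp

text \<open>The weak topology is an initial topology, so continuity into it can be tested after
  composition with functionals.\<close>

lemma continuous_map_into_weak:
  fixes g :: "'b \<Rightarrow> 'a::real_normed_vector"
  assumes "\<And>f :: 'a \<Rightarrow> real. bounded_linear f \<Longrightarrow> continuous_map X euclideanreal (\<lambda>x. f (g x))"
  shows "continuous_map X weak_topology g"
  unfolding weak_topology_def
proof (rule continuous_on_generated_topo)
  fix V assume "V \<in> {f -` U | (f :: 'a \<Rightarrow> real) U. bounded_linear f \<and> open U}"
  then obtain f :: "'a \<Rightarrow> real" and U where V: "V = f -` U" "bounded_linear f" "open U" by auto
  have "openin X {x \<in> topspace X. f (g x) \<in> U}"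
    using assms[OF V(2)] V(3) by (simp add: continuous_map_def)
  moreover have "{x \<in> topspace X. f (g x) \<in> U} = g -` V \<inter> topspace X"
    using V by auto
  ultimately show "openin X (g -` V \<inter> topspace X)" by simp
next
  show "g ` topspace X \<subseteq> \<Union> {f -` U | (f :: 'a \<Rightarrow> real) U. bounded_linear f \<and> open U}"
    using topspace_weak_topology[where 'a='a]
    unfolding weak_topology_def topology_generated_by_topspace by (simp only: subset_UNIV)
qed

lemma openin_weak_imp_open:
  assumes "openin weak_topology (U :: 'a::real_normed_vector set)"
  shows "open U"
proof -
  have "continuous_map (euclidean :: 'a topology) weak_topology (\<lambda>x. x)"
    by (rule continuous_map_into_weak) (simp add: linear_continuous_on)
  then show ?thesis
    using assms by (auto simp: continuous_map_def)
qed

text \<open>After a functional \<open>f\<close> the map becomes \<open>a * f x + f y\<close>, which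
  is jointly continuous. Hence combinations with scalars from a compact set preserve weak
  compactness.\<close>

lemma continuous_map_weak_axpy:
  "continuous_map (prod_topology euclideanreal
      (prod_topology weak_topology (weak_topology :: 'a::real_normed_vector topology)))
    weak_topology (\<lambda>(a, x, y). a *\<^sub>R x + y)"
proof (rule continuous_map_into_weak)
  fix f :: "'a \<Rightarrow> real" assume f: "bounded_linear f"
  interpret f: bounded_linear f by fact
  let ?T = "prod_topology euclideanreal
      (prod_topology weak_topology (weak_topology :: 'a topology))"
  have 1: "continuous_map ?T euclideanreal (\<lambda>z. fst z)"
    by (rule continuous_map_fst)
  have 2: "continuous_map ?T euclideanreal (\<lambda>z. f (fst (snd z)))"
    using continuous_map_compose[OF continuous_map_compose[OF continuous_map_snd continuous_map_fst]
        continuous_map_weak_functional[OF f]] by (simp add: comp_def)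
  have 3: "continuous_map ?T euclideanreal (\<lambda>z. f (snd (snd z)))"
    using continuous_map_compose[OF continuous_map_compose[OF continuous_map_snd continuous_map_snd]
        continuous_map_weak_functional[OF f]] by (simp add: comp_def)
  have "continuous_map ?T euclideanreal (\<lambda>z. fst z * f (fst (snd z)) + f (snd (snd z)))"
    by (intro continuous_map_add continuous_map_real_mult 1 2 3)
  then show "continuous_map ?T euclideanreal (\<lambda>z. f (case z of (a, x, y) \<Rightarrow> a *\<^sub>R x + y))"
    by (simp add: case_prod_unfold f.add f.scaleR)
qed

lemma compactin_weak_axpy:
  fixes K L :: "'a::real_normed_vector set"
  assumes "compact A" "compactin weak_topology K" "compactin weak_topology L"
  shows "compactin weak_topology ((\<lambda>(a, x, y). a *\<^sub>R x + y) ` (A \<times> K \<times> L))"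
proof -
  have "compactin (prod_topology euclideanreal (prod_topology weak_topology weak_topology)) (A \<times> K \<times> L)"
    using assms by (simp add: compactin_Times)
  then show ?thesis
    by (rule image_compactin[OF _ continuous_map_weak_axpy])
qed

text \<open>Uniform boundedness through the Baire category theorem in the dual space: each
  functional is bounded on \<open>K\<close>, so the closed sets \<open>F n\<close> cover the dual
  and one of them contains a ball.\<close>

lemma weak_compact_imp_bounded:
  fixes K :: "'a::real_normed_vector set"
  assumes K: "compactin weak_topology K"
  shows "bounded K"
proof -
  define F where "F n = {f :: 'a \<Rightarrow>\<^sub>L real. \<forall>x\<in>K. \<bar>f x\<bar> \<le> real n}" for n :: nat
  have "\<exists>n. f \<in> F n" for f
  proof -
    have "compact (blinfun_apply f ` K)"
      using image_compactin[OF K continuous_map_weak_functional[OF blinfun.bounded_linear_right]]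
      by (simp only: compactin_euclidean_iff)
    from compact_imp_bounded[OF this] obtain B where B: "\<forall>x\<in>K. \<bar>f x\<bar> \<le> B"
      unfolding bounded_real by auto
    obtain n where "B \<le> real n" using real_arch_simple by blast
    with B have "f \<in> F n" unfolding F_def by fastforce
    then show ?thesis ..
  qed
  then have un: "\<Union> (range F) = UNIV" by auto
  have closed: "closed (F n)" for n
  proof -
    have "F n = (\<Inter>x\<in>K. {f. \<bar>blinfun_apply f x\<bar> \<le> real n})" unfolding F_def by blast
    then show ?thesis
      by (simp only:) (intro closed_INT ballI closed_Collect_le continuous_intros)
  qed
  have "\<exists>n. interior (F n) \<noteq> {}"
  proof (rule ccontr)
    assume "\<nexists>n. interior (F n) \<noteq> {}"
    moreover have "euclidean interior_of S = interior S" for S :: "('a \<Rightarrow>\<^sub>L real) set"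
      by (auto simp: interior_of_def interior_def)
    ultimately have "euclidean interior_of \<Union> (range F) = {}"
      using closed by (intro Baire_category_alt) (auto simp: completely_metrizable_space_euclidean)
    then show False using un by simp
  qed
  then obtain n g where "g \<in> interior (F n)" by blast
  then obtain e where g: "e > 0" "cball g e \<subseteq> F n" by (auto simp: mem_interior_cball)
  have "norm x \<le> 2 * real n / e" if x: "x \<in> K" for x
  proof -
    obtain f :: "'a \<Rightarrow> real" where f: "bounded_linear f" "\<And>z. \<bar>f z\<bar> \<le> norm z" "f x = norm x"
      using norming_functional[of x] by blast
    \<comment> \<open>Both \<open>g\<close> and \<open>h\<close> lie in the ball inside
      \<open>F n\<close>, and their values at \<open>x\<close> differ by exactly
      \<open>e * norm x\<close>.\<close>
    define h where "h = g + e *\<^sub>R Blinfun f"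
    have "norm (Blinfun f) \<le> 1"
      using f by (intro norm_blinfun_bound) (auto simp: bounded_linear_Blinfun_apply)
    then have "h \<in> F n" "g \<in> F n"
      using g by (auto simp: h_def dist_norm intro!: subsetD[OF g(2)])
    then have "\<bar>h x\<bar> \<le> n" "\<bar>g x\<bar> \<le> n" using x by (auto simp: F_def)
    moreover have "h x = g x + e * norm x"
      by (simp add: h_def blinfun.add_left blinfun.scaleR_left bounded_linear_Blinfun_apply f)
    ultimately have "e * norm x \<le> 2 * real n" by linarith
    then show ?thesis using g(1) by (simp add: field_simps)
  qed
  then show ?thesis by (auto simp: bounded_iff)
qed

section \<open>Sequential arguments in weakly compact sets\<close>

text \<open>Density of the rationals gives real scalars for vectors of \<open>U\<close>, and
  sequences then reach the closure. Rational scalars allow \<open>U\<close> to be built from finite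
  stages below.\<close>

lemma subspace_closure_rational:
  fixes U :: "'a::real_normed_vector set"
  assumes "0 \<in> U" and rat: "\<And>q u v. u \<in> U \<Longrightarrow> v \<in> U \<Longrightarrow> of_rat q *\<^sub>R u + v \<in> U"
  shows "subspace (closure U)"
proof -
  have real: "r *\<^sub>R u + v \<in> closure U" if "u \<in> U" "v \<in> U" for r :: real and u v
  proof -
    have "(\<lambda>r. r *\<^sub>R u + v) ` closure \<rat> \<subseteq> closure U"
      using rat[OF that] closure_subset[of U]
      by (intro image_closure_subset continuous_intros) (auto simp: Rats_def)
    moreover have "closure \<rat> = (UNIV :: real set)"
    proof -
      have "\<exists>q\<in>\<rat>. dist q s < e" if "e > 0" for s e :: real
      proof -
        obtain q where "q \<in> \<rat>" "s < q" "q < s + e"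
          using Rats_dense_in_real[of s "s + e"] \<open>e > 0\<close> by auto
        then show ?thesis by (intro bexI[of _ q]) (auto simp: dist_real_def)
      qed
      then have "s \<in> closure \<rat>" for s :: real
        unfolding closure_approachable by blast
      then show ?thesis by blast
    qed
    ultimately show ?thesis by auto
  qed
  have comb: "r *\<^sub>R u + v \<in> closure U" if "u \<in> closure U" "v \<in> closure U" for r :: real and u v
  proof -
    obtain us vs where us: "\<And>n::nat. us n \<in> U" "us \<longlonglongrightarrow> u" and vs: "\<And>n::nat. vs n \<in> U" "vs \<longlonglongrightarrow> v"
      using \<open>u \<in> closure U\<close> \<open>v \<in> closure U\<close> unfolding closure_sequential by auto
    have "(\<lambda>n. r *\<^sub>R us n + vs n) \<longlonglongrightarrow> r *\<^sub>R u + v"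
      by (intro tendsto_intros us vs)
    then show ?thesis
      by (rule closed_sequentially[OF closed_closure real[OF us(1) vs(1)]])
  qed
  have zero: "0 \<in> closure U" using \<open>0 \<in> U\<close> closure_subset by auto
  show ?thesis
  proof (rule subspaceI)
    show "u + v \<in> closure U" if "u \<in> closure U" "v \<in> closure U" for u v
      using comb[OF that, of 1] by simp
    show "c *\<^sub>R u \<in> closure U" if "u \<in> closure U" for c u
      using comb[OF that zero, of c] by simp
  qed (rule zero)
qed

lemma openin_weak_functional:
  fixes f :: "'a::real_normed_vector \<Rightarrow> real"
  assumes "bounded_linear f" "open S"
  shows "openin weak_topology {z. f z \<in> S}"
  using continuous_map_weak_functional[OF assms(1)] assms(2) by (simp add: continuous_map_def)

text \<open>Otherwise \<open>K\<close> is covered by open sets that each catch finitely many indices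
  of \<open>N\<close>, and a finite subcover would make \<open>N\<close> finite. Indices are counted
  rather than values, so repeated terms do no harm.\<close>

lemma compactin_cluster_point:
  assumes K: "compactin X K" and a: "\<And>n. a n \<in> K" and N: "infinite (N :: 'b set)"
  obtains y where "y \<in> K" "\<And>U. openin X U \<Longrightarrow> y \<in> U \<Longrightarrow> infinite {n \<in> N. a n \<in> U}"
proof (rule ccontr)
  assume "\<not> thesis"
  with that have ex: "\<exists>U. openin X U \<and> y \<in> U \<and> finite {n \<in> N. a n \<in> U}" if "y \<in> K" for y
    using \<open>y \<in> K\<close> by blast
  define \<U> where "\<U> = {U. openin X U \<and> finite {n \<in> N. a n \<in> U}}"
  have "\<forall>U\<in>\<U>. openin X U" by (simp add: \<U>_def)
  moreover have "K \<subseteq> \<Union>\<U>" using ex unfolding \<U>_def by blast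
  ultimately obtain \<F> where F: "finite \<F>" "\<F> \<subseteq> \<U>" "K \<subseteq> \<Union>\<F>"
    using K[unfolded compactin_def] by metis
  have "N \<subseteq> (\<Union>U\<in>\<F>. {n \<in> N. a n \<in> U})"
    using a F(3) by blast
  moreover have "finite (\<Union>U\<in>\<F>. {n \<in> N. a n \<in> U})"
    using F by (auto simp: \<U>_def)
  ultimately show False using N finite_subset by blast
qed

text \<open>For \<open>v \<in> U\<close> closer to \<open>z\<close> than half its norm,
  \<open>norm v = \<phi> v (v - z) \<le> dist v z\<close>. Then \<open>norm z\<close> is at most
  \<open>norm v + dist v z\<close>, which is less than \<open>norm z\<close>.\<close>

lemma norming_family_separates:
  fixes \<phi> :: "'a::real_normed_vector \<Rightarrow> 'a \<Rightarrow> real"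
  assumes bl: "\<And>v. bounded_linear (\<phi> v)" and le: "\<And>v z. \<bar>\<phi> v z\<bar> \<le> norm z"
    and norming: "\<And>v. \<phi> v v = norm v"
    and z: "z \<in> closure U" "\<And>v. v \<in> U \<Longrightarrow> \<phi> v z = 0"
  shows "z = 0"
proof (rule ccontr)
  assume "z \<noteq> 0"
  then have "norm z / 2 > 0" by simp
  with z(1) obtain v where v: "v \<in> U" "dist v z < norm z / 2"
    unfolding closure_approachable by blast
  have "norm v = \<phi> v (v - z)"
    using norming[of v] z(2)[OF v(1)] linear_diff[OF bounded_linear.linear[OF bl], of v v z] by simp
  also have "\<dots> \<le> dist v z"
    using le[of v "v - z"] by (simp add: dist_norm)
  finally have "norm v < norm z / 2" using v(2) by simp
  moreover have "norm z \<le> norm v + dist v z"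
    using norm_triangle_ineq4[of v "v - z"] by (simp add: dist_norm)
  ultimately show False using v(2) by simp
qed

text \<open>Whitley's construction: each new term of the sequence is close to \<open>x\<close> on functionals
  norming larger and larger finite sets of rational combinations of the earlier differences
  \<open>a i - x\<close>. A cluster point \<open>y\<close> then satisfies \<open>y - x \<in> Z\<close> for the closed span \<open>Z\<close> of these
  differences, while the chosen functionals separate the points of \<open>Z\<close> and vanish at \<open>y - x\<close>.\<close>

lemma weak_compact_adherent_sequence:
  fixes K :: "'a::real_normed_vector set"
  assumes K: "compactin weak_topology K" and A: "A \<subseteq> K"
    and adh: "\<And>F e. finite F \<Longrightarrow> \<forall>f\<in>F. bounded_linear f \<Longrightarrow> e > 0 \<Longrightarrow>
      \<exists>a\<in>A. \<forall>f\<in>F. \<bar>f a - f x\<bar> < (e :: real)"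
  shows "\<exists>a :: nat \<Rightarrow> 'a. (\<forall>n. a n \<in> A) \<and> limitin weak_topology a x sequentially"
proof -
  have "\<forall>v :: 'a. \<exists>f :: 'a \<Rightarrow> real. bounded_linear f \<and> (\<forall>z. \<bar>f z\<bar> \<le> norm z) \<and> f v = norm v"
    using norming_functional by blast
  then obtain \<phi> :: "'a \<Rightarrow> 'a \<Rightarrow> real" where bl: "\<And>v. bounded_linear (\<phi> v)"
    and le: "\<And>v z. \<bar>\<phi> v z\<bar> \<le> norm z" and norming: "\<And>v. \<phi> v v = norm v"
    by metis
  \<comment> \<open>A point of \<open>A\<close> that agrees with \<open>x\<close> up to
    \<open>1 / Suc n\<close> on the functionals norming the finite set \<open>V\<close>.\<close>
  define pick where "pick n V = (SOME a. a \<in> A \<and> (\<forall>v\<in>V. \<bar>\<phi> v a - \<phi> v x\<bar> < 1 / Suc n))" for n V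
  have pick_ex: "pick n V \<in> A \<and> (\<forall>v\<in>V. \<bar>\<phi> v (pick n V) - \<phi> v x\<bar> < 1 / Suc n)"
    if "finite V" for n V
    unfolding pick_def by (rule someI_ex) (use adh[of "\<phi> ` V" "1 / Suc n"] bl that in auto)
  then have pick: "\<And>n V. finite V \<Longrightarrow> pick n V \<in> A"
    "\<And>n V v. finite V \<Longrightarrow> v \<in> V \<Longrightarrow> \<bar>\<phi> v (pick n V) - \<phi> v x\<bar> < 1 / Suc n"
    by auto
  \<comment> \<open>Only the rationals with index at most \<open>n\<close> are used, which keeps
    each stage finite; since the enumeration is surjective and the stages grow, every rational
    combination appears eventually.\<close>
  define G where "G n W = W \<union> (\<lambda>(i, u, v). of_rat (nat_to_rat_surj i) *\<^sub>R u + v) ` ({..n} \<times> W \<times> W)"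
    for n and W :: "'a set"
  define V where "V = rec_nat {0} (\<lambda>n V. G n (insert (pick n V - x) V))"
  have V0: "V 0 = {0}" and VSuc: "\<And>n. V (Suc n) = G n (insert (pick n (V n) - x) (V n))"
    by (simp_all add: V_def)
  define a where "a n = pick n (V n)" for n
  define U where "U = (\<Union>n. V n)"
  have fin: "finite (V n)" for n
    by (induction n) (simp_all add: V0 VSuc G_def)
  have mono: "V m \<subseteq> V n" if "m \<le> n" for m n
    using that by (rule lift_Suc_mono_le[rotated]) (auto simp: VSuc G_def)
  have aA: "a n \<in> A" for n using pick(1) fin by (simp add: a_def)
  have aU: "a n - x \<in> U" for n
  proof -
    have "a n - x \<in> V (Suc n)" by (simp add: VSuc G_def a_def)
    then show ?thesis unfolding U_def by blast
  qed
  define Z where "Z = closure U"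
  have Z: "subspace Z" "closed Z"
    unfolding Z_def
  proof (rule subspace_closure_rational)
    show "0 \<in> U" using V0 unfolding U_def by blast
    fix q :: rat and u v assume "u \<in> U" "v \<in> U"
    then obtain k l where kl: "u \<in> V k" "v \<in> V l" unfolding U_def by blast
    obtain i where i: "q = nat_to_rat_surj i" using surj_nat_to_rat_surj by blast
    define n where "n = max i (max k l)"
    have "u \<in> V n" "v \<in> V n" "i \<le> n" using kl mono[of k n] mono[of l n] by (auto simp: n_def subset_iff)
    then have "of_rat q *\<^sub>R u + v \<in> V (Suc n)"
      unfolding VSuc G_def i by force
    then show "of_rat q *\<^sub>R u + v \<in> U" unfolding U_def by blast
  qed simp
  have "(\<lambda>n. f (a n)) \<longlonglongrightarrow> f x" if f: "bounded_linear f" for f :: "'a \<Rightarrow> real"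
  proof (rule ccontr)
    assume "\<not> (\<lambda>n. f (a n)) \<longlonglongrightarrow> f x"
    then obtain e where e: "e > 0" "\<not> eventually (\<lambda>n. dist (f (a n)) (f x) < e) sequentially"
      unfolding tendsto_iff by blast
    \<comment> \<open>The cluster point is taken along the indices where convergence fails, so
      \<open>f y\<close> stays at distance at least \<open>e\<close> from \<open>f x\<close>. The
      contradiction will be \<open>y = x\<close>.\<close>
    define N where "N = {n. \<bar>f (a n) - f x\<bar> \<ge> e}"
    have "infinite N"
      using e(2) unfolding N_def cofinite_eq_sequentially[symmetric] eventually_cofinite
      by (simp add: dist_real_def not_less)
    then obtain y where y: "y \<in> K"
      "\<And>U. openin weak_topology U \<Longrightarrow> y \<in> U \<Longrightarrow> infinite {n \<in> N. a n \<in> U}"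
      using compactin_cluster_point[OF K, of a N] aA A by blast
    have cluster: "infinite {n \<in> N. g (a n) \<in> S}"
      if "bounded_linear g" "open S" "g y \<in> S" for g :: "'a \<Rightarrow> real" and S
      using y(2)[OF openin_weak_functional[OF that(1,2)]] that(3) by simp
    have fy: "\<bar>f y - f x\<bar> \<ge> e"
    proof (rule ccontr)
      assume "\<not> ?thesis"
      then have "infinite {n \<in> N. f (a n) \<in> ball (f x) e}"
        by (intro cluster f) (auto simp: dist_real_def)
      moreover have "{n \<in> N. f (a n) \<in> ball (f x) e} = {}"
        by (auto simp: N_def dist_real_def abs_minus_commute not_less)
      ultimately show False by (metis finite.emptyI)
    qed
    \<comment> \<open>A functional vanishing on \<open>Z\<close> has the constant value
      \<open>g x\<close> along the sequence, so it cannot separate \<open>y\<close> from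
      \<open>x\<close>.\<close>
    have "y - x \<in> Z"
    proof (rule ccontr)
      assume "y - x \<notin> Z"
      then obtain g :: "'a \<Rightarrow> real" where g: "bounded_linear g" "\<And>z. z \<in> Z \<Longrightarrow> g z = 0" "g (y - x) \<noteq> 0"
        using separating_functional_subspace[OF Z] by blast
      note gdiff = linear_diff[OF bounded_linear.linear[OF g(1)]]
      have "infinite {n \<in> N. g (a n) \<in> - {g x}}"
        by (intro cluster g) (use g(3) gdiff in auto)
      moreover have "g (a n) = g x" for n
        using g(2)[of "a n - x"] aU[of n] closure_subset[of U] gdiff[of "a n" x] by (auto simp: Z_def)
      ultimately show False by simp
    qed
    \<comment> \<open>From the stage containing \<open>v\<close> on, the values
      \<open>\<phi> v (a n)\<close> are within \<open>1 / Suc n\<close> of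
      \<open>\<phi> v x\<close>, so they cannot cluster at a different value.\<close>
    moreover have "\<phi> v (y - x) = 0" if v: "v \<in> U" for v
    proof (rule ccontr)
      assume "\<phi> v (y - x) \<noteq> 0"
      then have ne: "\<phi> v y \<noteq> \<phi> v x"
        using linear_diff[OF bounded_linear.linear[OF bl[of v]], of y x] by simp
      define d where "d = \<bar>\<phi> v y - \<phi> v x\<bar> / 2"
      have d: "d > 0" using ne by (simp add: d_def)
      obtain m where m: "v \<in> V m" using v unfolding U_def by blast
      obtain k where k: "1 / Suc k < d" using nat_approx_posE[OF d] by blast
      have "\<bar>\<phi> v (a n) - \<phi> v x\<bar> < d" if "n \<ge> max m k" for n
      proof -
        have "\<bar>\<phi> v (a n) - \<phi> v x\<bar> < 1 / Suc n"
          unfolding a_def using m mono[of m n] that by (intro pick fin) auto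
        also have "\<dots> \<le> 1 / Suc k" using that by (simp add: frac_le)
        finally show ?thesis using k by simp
      qed
      then have near: "\<phi> v (a n) \<in> cball (\<phi> v x) d" if "n \<ge> max m k" for n
        using that by (force simp: dist_real_def abs_minus_commute)
      have "{n \<in> N. \<phi> v (a n) \<in> - cball (\<phi> v x) d} \<subseteq> {..< max m k}"
      proof
        fix n assume "n \<in> {n \<in> N. \<phi> v (a n) \<in> - cball (\<phi> v x) d}"
        with near[of n] show "n \<in> {..< max m k}" by (cases "n \<ge> max m k") auto
      qed
      then have "finite {n \<in> N. \<phi> v (a n) \<in> - cball (\<phi> v x) d}"
        by (rule finite_subset) simp
      moreover have "infinite {n \<in> N. \<phi> v (a n) \<in> - cball (\<phi> v x) d}"
        by (intro cluster bl) (use ne in \<open>auto simp: dist_real_def d_def abs_minus_commute\<close>)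
      ultimately show False by simp
    qed
    ultimately have "y - x = 0"
      unfolding Z_def by (rule norming_family_separates[OF bl le norming])
    with fy e(1) show False by simp
  qed
  then have "limitin weak_topology a x sequentially"
    by (simp add: limitin_weak_topology)
  with aA show ?thesis by blast
qed

text \<open>The map is shown to be weakly continuous on \<open>K\<close>. Where continuity failed at
  \<open>x\<close>, the offending points of \<open>K\<close> would be weakly adherent to
  \<open>x\<close>, hence contain a sequence converging weakly to \<open>x\<close>, against
  sequential continuity.\<close>

lemma compactin_weak_seq_continuous_image:
  fixes K :: "'a::real_normed_vector set" and p :: "'a \<Rightarrow> 'b::real_normed_vector"
  assumes K: "compactin weak_topology K"
    and p: "\<And>a x. limitin weak_topology a x sequentially \<Longrightarrow>
      limitin weak_topology (\<lambda>n. p (a n)) (p x) sequentially"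
  shows "compactin weak_topology (p ` K)"
proof (rule image_compactin)
  show "compactin (subtopology weak_topology K) K"
    using K by (simp add: compactin_subtopology)
  show "continuous_map (subtopology weak_topology K) weak_topology p"
  proof (rule continuous_map_into_weak)
    fix f :: "'b \<Rightarrow> real" assume f: "bounded_linear f"
    show "continuous_map (subtopology weak_topology K) euclideanreal (\<lambda>x. f (p x))"
      unfolding continuous_map_def
    proof (intro conjI allI impI)
      fix S :: "real set" assume "openin euclideanreal S"
      then have S: "open S" by simp
      have "\<exists>T. openin (subtopology weak_topology K) T \<and> x \<in> T \<and> T \<subseteq> {x \<in> K. f (p x) \<in> S}"
        if x: "x \<in> K" "f (p x) \<in> S" for x
      proof -
        have "\<exists>F e. finite F \<and> (\<forall>g\<in>F. bounded_linear g) \<and> e > 0 \<and>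
          (\<forall>a\<in>K. (\<forall>g\<in>F. \<bar>g a - g x\<bar> < (e :: real)) \<longrightarrow> f (p a) \<in> S)"
        proof (rule ccontr)
          assume neg: "\<not> ?thesis"
          define A where "A = {a \<in> K. f (p a) \<notin> S}"
          have adh: "\<exists>a\<in>A. \<forall>g\<in>F. \<bar>g a - g x\<bar> < e"
            if "finite F" "\<forall>g\<in>F. bounded_linear g" "e > 0" for F and e :: real
          proof (rule ccontr)
            assume "\<not> ?thesis"
            then have "\<forall>a\<in>K. (\<forall>g\<in>F. \<bar>g a - g x\<bar> < e) \<longrightarrow> f (p a) \<in> S"
              by (auto simp: A_def)
            with neg that show False by blast
          qed
          have "A \<subseteq> K" by (auto simp: A_def)
          then have "\<exists>a :: nat \<Rightarrow> 'a. (\<forall>n. a n \<in> A) \<and> limitin weak_topology a x sequentially"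
            using adh by (rule weak_compact_adherent_sequence[OF K])
          then obtain a :: "nat \<Rightarrow> 'a"
            where a: "\<forall>n. a n \<in> A" "limitin weak_topology a x sequentially" by blast
          have "(\<lambda>n. f (p (a n))) \<longlonglongrightarrow> f (p x)"
            using p[OF a(2)] f by (simp add: limitin_weak_topology)
          then have "eventually (\<lambda>n. f (p (a n)) \<in> S) sequentially"
            using S x(2) by (rule topological_tendstoD)
          then show False using a(1) by (auto simp: A_def eventually_sequentially)
        qed
        then obtain F e where F: "finite F" "\<forall>g\<in>F. bounded_linear g" "e > (0::real)"
          "\<forall>a\<in>K. (\<forall>g\<in>F. \<bar>g a - g x\<bar> < e) \<longrightarrow> f (p a) \<in> S"
          by (elim exE conjE)
        define T where "T = topspace weak_topology \<inter> (\<Inter>g\<in>F. {z. g z \<in> ball (g x) e})"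
        have "openin weak_topology T"
        proof (cases "F = {}")
          case False
          then have "openin weak_topology (\<Inter>g\<in>F. {z. g z \<in> ball (g x) e})"
            using F by (intro openin_INT2) (auto intro!: openin_weak_functional simp del: mem_ball)
          then show ?thesis by (simp add: T_def)
        qed (use openin_topspace[of weak_topology] in \<open>simp add: T_def\<close>)
        then have "openin (subtopology weak_topology K) (T \<inter> K)"
          by (auto simp: openin_subtopology)
        moreover have "x \<in> T \<inter> K" using x F(3) by (simp add: T_def)
        moreover have "T \<inter> K \<subseteq> {x \<in> K. f (p x) \<in> S}"
          using F(4) by (auto simp: T_def dist_real_def abs_minus_commute)
        ultimately show ?thesis by blast
      qed
      then show "openin (subtopology weak_topology K)
          {x \<in> topspace (subtopology weak_topology K). f (p x) \<in> S}"
        by (subst openin_subopen) auto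
    qed simp
  qed
qed

section \<open>Rescaling and countable unions of weakly compact sets\<close>

lemma compactin_weak_scale:
  fixes K :: "'a::real_normed_vector set"
  assumes "compactin weak_topology K"
  shows "compactin weak_topology ((\<lambda>x. c *\<^sub>R x) ` K)"
  by (rule image_compactin[OF assms continuous_map_into_weak],
      rule continuous_map_weak_functional, rule bounded_linear_compose[OF _ bounded_linear_scaleR_right])

text \<open>A member of the open cover that contains \<open>0\<close> is also norm open, so it
  absorbs all but finitely many of the shrinking sets. The rest form a finite union of weakly
  compact sets.\<close>

lemma weak_compact_scaled_Union:
  fixes K :: "nat \<Rightarrow> 'a::real_normed_vector set"
  assumes K: "\<And>n. compactin weak_topology (K n)"
  shows "\<exists>c :: nat \<Rightarrow> real. (\<forall>n. c n > 0) \<and>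
    compactin weak_topology (insert 0 (\<Union>n. (\<lambda>x. c n *\<^sub>R x) ` K n))"
proof -
  have "\<forall>n. \<exists>M>0. \<forall>x\<in>K n. norm x \<le> M"
    using weak_compact_imp_bounded[OF K] unfolding bounded_pos by blast
  then obtain M where M: "\<And>n. M n > 0" "\<And>n x. x \<in> K n \<Longrightarrow> norm x \<le> M n"
    by metis
  define c where "c n = 1 / (Suc n * M n)" for n
  have c: "c n > 0" for n using M(1) by (simp add: c_def)
  have small: "norm (c n *\<^sub>R x) \<le> 1 / Suc n" if "x \<in> K n" for n x
  proof -
    have "norm (c n *\<^sub>R x) \<le> c n * M n"
      using M(2)[OF that] c[of n] by simp
    then show ?thesis using M(1)[of n] by (simp add: c_def)
  qed
  define T where "T n = (\<lambda>x. c n *\<^sub>R x) ` K n" for n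
  have T: "compactin weak_topology (T n)" for n
    unfolding T_def by (rule compactin_weak_scale[OF K])
  have "\<exists>\<F>. finite \<F> \<and> \<F> \<subseteq> \<U> \<and> insert 0 (\<Union>n. T n) \<subseteq> \<Union>\<F>"
    if op: "\<forall>U\<in>\<U>. openin weak_topology U" and cov: "insert 0 (\<Union>n. T n) \<subseteq> \<Union>\<U>" for \<U>
  proof -
    obtain U0 where U0: "U0 \<in> \<U>" "0 \<in> U0" using cov by blast
    then have "open U0" using op openin_weak_imp_open by blast
    then obtain e where e: "e > 0" "ball 0 e \<subseteq> U0"
      using U0(2) open_contains_ball by blast
    obtain N where N: "1 / Suc N < e" using nat_approx_posE[OF e(1)] by blast
    have tail: "T n \<subseteq> U0" if "n \<ge> N" for n
    proof
      fix z assume "z \<in> T n"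
      then have "norm z \<le> 1 / Suc n" using small by (auto simp: T_def)
      also have "\<dots> \<le> 1 / Suc N" using that by (simp add: frac_le)
      finally show "z \<in> U0" using N e(2) by auto
    qed
    have "compactin weak_topology (\<Union> (T ` {..<N}))"
      by (rule compactin_Union) (use T in auto)
    moreover have "\<Union> (T ` {..<N}) \<subseteq> \<Union>\<U>" using cov by blast
    ultimately obtain \<F> where F: "finite \<F>" "\<F> \<subseteq> \<U>" "\<Union> (T ` {..<N}) \<subseteq> \<Union>\<F>"
      using op unfolding compactin_def by metis
    have "T n \<subseteq> \<Union> (insert U0 \<F>)" for n
      using tail[of n] F(3) by (cases "n < N") auto
    then have "insert 0 (\<Union>n. T n) \<subseteq> \<Union> (insert U0 \<F>)" using U0 by blast
    then show ?thesis using F(1,2) U0(1) by (intro exI[of _ "insert U0 \<F>"]) auto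
  qed
  then have "compactin weak_topology (insert 0 (\<Union>n. T n))"
    by (simp add: compactin_def)
  with c show ?thesis unfolding T_def by (intro exI[of _ c]) simp
qed

section \<open>Generating sublattices\<close>

text \<open>Makes the identities of lattice-ordered groups available, such as
  \<open>add_sup_distrib_right\<close> and \<open>add_eq_inf_sup\<close>.\<close>

instance banach_lattice \<subseteq> lattice_ab_group_add ..

text \<open>The modulus of the difference of the positive parts is at most the modulus of
  \<open>x - y\<close>, and the norm is monotone in the modulus.\<close>

lemma norm_sup_zero_diff_le:
  fixes x y :: "'a::banach_lattice"
  shows "norm (sup x 0 - sup y 0) \<le> norm (x - y)"
proof (rule norm_mono_modulus)
  have le: "sup u 0 - sup v 0 \<le> sup (u - v) (v - u)" for u v :: 'a
  proof -
    define m where "m = sup (u - v) (v - u)"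
    have m: "u - v \<le> m" "v - u \<le> m" by (simp_all add: m_def)
    \<comment> \<open>The two elements below \<open>m\<close> are opposite, so adding the
      inequalities and halving gives \<open>0 \<le> m\<close>.\<close>
    have "0 \<le> 2 *\<^sub>R m" using add_mono[OF m] by (simp add: scaleR_2)
    then have "(1/2) *\<^sub>R 0 \<le> (1/2) *\<^sub>R 2 *\<^sub>R m" by (intro scaleR_left_mono) auto
    then have "0 \<le> m" by simp
    have "u \<le> m + sup v 0"
      using add_mono[OF m(1) sup_ge1[of v 0]] by simp
    moreover have "0 \<le> m + sup v 0"
      using add_mono[OF \<open>0 \<le> m\<close> sup_ge2[of 0 v]] by simp
    ultimately have "sup u 0 \<le> m + sup v 0" by (rule sup_least)
    then show ?thesis unfolding m_def[symmetric] by (simp only: diff_le_eq)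
  qed
  show "sup (sup x 0 - sup y 0) (- (sup x 0 - sup y 0)) \<le> sup (x - y) (- (x - y))"
    unfolding minus_diff_eq by (intro sup_least le) (subst sup.commute, rule le)
qed

text \<open>Positive parts determine both operations: \<open>sup x y = sup (x - y) 0 + y\<close>,
  and \<open>inf x y\<close> is \<open>x + y - sup x y\<close>.\<close>

lemma closed_sublatticeI:
  fixes Z :: "'a::banach_lattice set"
  assumes Z: "subspace Z" "closed Z" and pos: "\<And>x. x \<in> Z \<Longrightarrow> sup x 0 \<in> Z"
  shows "closed_sublattice Z"
proof -
  have sup: "sup x y \<in> Z" if "x \<in> Z" "y \<in> Z" for x y
  proof -
    have "sup x y = sup (x - y) 0 + y" by (simp add: add_sup_distrib_right)
    also have "\<dots> \<in> Z" by (intro subspace_add subspace_diff pos Z that)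
    finally show ?thesis .
  qed
  moreover have "inf x y \<in> Z" if "x \<in> Z" "y \<in> Z" for x y
  proof -
    have "inf x y = x + y - sup x y" by (simp only: add_eq_inf_sup[of x y] add_diff_cancel_left')
    also have "\<dots> \<in> Z" by (intro subspace_add subspace_diff sup Z that)
    finally show ?thesis .
  qed
  ultimately show ?thesis using Z unfolding closed_sublattice_def by blast
qed

text \<open>Taking positive parts is nonexpansive, hence norm continuous, so it maps the closure of
  \<open>Y\<close> into itself.\<close>

lemma closed_sublattice_closure:
  fixes Y :: "'a::banach_lattice set"
  assumes Y: "subspace Y" and pos: "\<And>x. x \<in> Y \<Longrightarrow> sup x 0 \<in> Y"
  shows "closed_sublattice (closure Y)"
proof (rule closed_sublatticeI)
  show "subspace (closure Y)"
    by (intro subspace_closure_rational subspace_0 subspace_add subspace_scale Y)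
  have "1-lipschitz_on (closure Y) (\<lambda>x. sup x 0)"
  proof (rule lipschitz_onI)
    show "dist (sup x 0) (sup y 0) \<le> 1 * dist x y" for x y :: 'a
      unfolding dist_norm mult_1 by (rule norm_sup_zero_diff_le)
  qed simp
  then have "continuous_on (closure Y) (\<lambda>x. sup x 0)"
    by (rule lipschitz_on_continuous_on)
  then have "(\<lambda>x. sup x 0) ` closure Y \<subseteq> closure Y"
    by (rule image_closure_subset) (use pos closure_subset in auto)
  then show "sup x 0 \<in> closure Y" if "x \<in> closure Y" for x
    using that by blast
qed simp

text \<open>The growing range of scalars makes the union of the stages a subspace while each stage
  stays weakly compact.\<close>

fun lattice_stage :: "'a::banach_lattice set \<Rightarrow> nat \<Rightarrow> 'a set" where
  "lattice_stage K 0 = insert 0 K"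
| "lattice_stage K (Suc n) = lattice_stage K n \<union> (\<lambda>x. sup x 0) ` lattice_stage K n \<union>
     (\<lambda>(a, x, y). a *\<^sub>R x + y) ` ({- real n..real n} \<times> lattice_stage K n \<times> lattice_stage K n)"

lemma lattice_stage_mono: "m \<le> n \<Longrightarrow> lattice_stage K m \<subseteq> lattice_stage K n"
  by (rule lift_Suc_mono_le) auto

lemma compactin_lattice_stage:
  fixes K :: "'a::banach_lattice set"
  assumes lat: "weakly_seq_continuous_lattice_ops TYPE('a)" and K: "compactin weak_topology K"
  shows "compactin weak_topology (lattice_stage K n)"
proof (induction n)
  case 0
  have "compactin weak_topology ({0} \<union> K)"
    using K by (intro compactin_Un) auto
  then show ?case by simp
next
  case (Suc n)
  \<comment> \<open>The lattice hypothesis is applied with the constant sequence \<open>0\<close> as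
    second argument.\<close>
  have pos: "limitin weak_topology (\<lambda>n. sup (a n) 0) (sup x 0) sequentially"
    if "limitin weak_topology a x sequentially" for a :: "nat \<Rightarrow> 'a" and x
  proof -
    have "limitin weak_topology (\<lambda>n. 0 :: 'a) 0 sequentially"
      by (simp add: limitin_weak_topology)
    with that lat show ?thesis
      unfolding weakly_seq_continuous_lattice_ops_def by blast
  qed
  show ?case
    unfolding lattice_stage.simps
    by (intro compactin_Un Suc compactin_weak_axpy[OF compact_Icc Suc Suc]
        compactin_weak_seq_continuous_image[OF Suc pos])
qed

lemma lattice_stage_Union:
  fixes K :: "'a::banach_lattice set"
  defines "Y \<equiv> \<Union>n. lattice_stage K n"
  shows "subspace Y" "x \<in> Y \<Longrightarrow> sup x 0 \<in> Y"
proof -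
  have comb: "c *\<^sub>R u + v \<in> Y" if uv: "u \<in> Y" "v \<in> Y" for c u v
  proof -
    obtain k l where kl: "u \<in> lattice_stage K k" "v \<in> lattice_stage K l"
      using uv unfolding Y_def by blast
    obtain j where j: "\<bar>c\<bar> \<le> real j" using real_arch_simple by blast
    \<comment> \<open>Stage \<open>n\<close> contains both vectors, and its scalar range contains
      \<open>c\<close>.\<close>
    define n where "n = max j (max k l)"
    have "u \<in> lattice_stage K n" "v \<in> lattice_stage K n"
      using kl lattice_stage_mono[of k n K] lattice_stage_mono[of l n K] by (auto simp: n_def subset_iff)
    moreover have "c \<in> {- real n..real n}" using j by (auto simp: n_def)
    ultimately have "c *\<^sub>R u + v \<in> lattice_stage K (Suc n)" by force
    then show ?thesis unfolding Y_def by blast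
  qed
  have "0 \<in> lattice_stage K 0" by simp
  then have zero: "0 \<in> Y" unfolding Y_def by blast
  show "subspace Y"
  proof (rule subspaceI)
    show "u + v \<in> Y" if "u \<in> Y" "v \<in> Y" for u v using comb[OF that, of 1] by simp
    show "c *\<^sub>R u \<in> Y" if "u \<in> Y" for c u using comb[OF that zero, of c] by simp
  qed (rule zero)
  show "sup x 0 \<in> Y" if x: "x \<in> Y"
  proof -
    obtain n where "x \<in> lattice_stage K n" using x unfolding Y_def by blast
    then have "sup x 0 \<in> lattice_stage K (Suc n)" by simp
    then show ?thesis unfolding Y_def by blast
  qed
qed

theorem theorem2p2:
  assumes "weakly_seq_continuous_lattice_ops TYPE('a::banach_lattice)"
  shows "LWCG TYPE('a) \<longleftrightarrow> WCG TYPE('a)"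
proof
  assume "LWCG TYPE('a)"
  then obtain K :: "'a set" where K: "compactin weak_topology K" and gen: "closed_sublattice hull K = UNIV"
    unfolding LWCG_def by blast
  define Y where "Y = (\<Union>n. lattice_stage K n)"
  have "closed_sublattice (closure Y)"
    unfolding Y_def by (intro closed_sublattice_closure lattice_stage_Union)
  moreover have "K \<subseteq> lattice_stage K 0" by auto
  then have "K \<subseteq> Y" unfolding Y_def by blast
  then have "K \<subseteq> closure Y" using closure_subset by blast
  ultimately have Y: "closure Y = UNIV" using hull_minimal[of K "closure Y" closed_sublattice] gen by blast
  obtain c :: "nat \<Rightarrow> real" where c: "\<forall>n. c n > 0"
    and T: "compactin weak_topology (insert 0 (\<Union>n. (\<lambda>x. c n *\<^sub>R x) ` lattice_stage K n))"
    using weak_compact_scaled_Union[of "lattice_stage K", OF compactin_lattice_stage[OF assms K]]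
    by (elim exE conjE)
  let ?T = "insert 0 (\<Union>n. (\<lambda>x. c n *\<^sub>R x) ` lattice_stage K n)"
  \<comment> \<open>The scalars \<open>c n\<close> are positive, so the rescaling can be undone
    inside the span.\<close>
  have "x \<in> span ?T" if "x \<in> lattice_stage K n" for x n
  proof -
    have "c n *\<^sub>R x \<in> span ?T" using that by (intro span_base) blast
    then have "inverse (c n) *\<^sub>R c n *\<^sub>R x \<in> span ?T" by (rule span_scale)
    then show ?thesis using c[THEN spec, of n] by simp
  qed
  then have "Y \<subseteq> span ?T" unfolding Y_def by blast
  then have "closure (span ?T) = UNIV" using closure_mono[of Y "span ?T"] Y by blast
  with T show "WCG TYPE('a)" unfolding WCG_def by (intro exI[of _ ?T] conjI)
next
  assume "WCG TYPE('a)"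
  then obtain K :: "'a set" where K: "compactin weak_topology K" and gen: "closure (span K) = UNIV"
    unfolding WCG_def by blast
  have L: "closed_sublattice (closed_sublattice hull K)" by (rule closed_sublattice_hull)
  \<comment> \<open>The hull is in particular a closed subspace, so the same \<open>K\<close>
    witnesses both properties.\<close>
  have "span K \<subseteq> closed_sublattice hull K"
    using L hull_subset[of K closed_sublattice] by (intro span_minimal) (auto simp: closed_sublattice_def)
  then have "closure (span K) \<subseteq> closed_sublattice hull K"
    using L by (intro closure_minimal) (auto simp: closed_sublattice_def)
  with gen K show "LWCG TYPE('a)" unfolding LWCG_def by (intro exI[of _ K]) auto
qed

end
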